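(* Let $\beta\in\mathbb{C}$ and let $(\mathfrak{s}^{1}_{4,1}(\beta),\cdot,[-,-])$ be a transposed Poisson algebra structure defined on the Lie algebra $\mathfrak{s}^{1}_{4,1}(\beta)$. Then the multiplication of $(\mathfrak{s}^{1}_{4,1}(\beta),\cdot)$ has one of the following forms (with complex parameters $\alpha_1,\alpha_2,\dots$; the value of $\beta$ to which each form belongs is indicated in its name): $\mathbf{TP}_1(\mathfrak{s}^{1}_{4,1}(1))$: $e_1\cdot e_1=\alpha_1e_3+\alpha_2e_4$, $e_1\cdot x=\alpha_2e_3+\alpha_3e_4$, $x\cdot x=\alpha_3e_3+\alpha_4e_4$; $\mathbf{TP}_2(\mathfrak{s}^{1}_{4,1}(2))$: $e_1\cdot e_1=e_2+\alpha_1e_3+\alpha_2e_4$, $e_1\cdot e_2=\alpha_3e_3+\frac12\alpha_1\alpha_3e_4$, $e_1\cdot e_3=\frac12\alpha_3e_4$, $e_2\cdot e_2=\frac12\alpha_3^2e_4$, $e_1\cdot x=\alpha_3e_1+\alpha_1e_2+2\alpha_2e_3+\alpha_4e_4$, $e_2\cdot x=\alpha_3e_2+\alpha_1\alpha_3e_3+\alpha_2\alpha_3e_4$, $e_3\cdot x=\alpha_3e_3+\frac12\alpha_1\alpha_3e_4$, $e_4\cdot x=\alpha_3e_4$, $x\cdot x=\alpha_1\alpha_3e_1+2\alpha_2e_2+2\alpha_4e_3+\alpha_5e_4+\alpha_3x$; $\mathbf{TP}_3(\mathfrak{s}^{1}_{4,1}(2))$: $e_1\cdot e_1=e_3+\alpha_1e_4$,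 $e_1\cdot e_2=\alpha_2e_4$, $e_1\cdot x=e_2+2\alpha_1e_3+\alpha_3e_4$, $e_2\cdot x=2\alpha_2e_3+2\alpha_1\alpha_2e_4$, $e_3\cdot x=\alpha_2e_4$, $x\cdot x=2\alpha_2e_1+2\alpha_1e_2+2\alpha_3e_3+\alpha_4e_4$; $\mathbf{TP}_4(\mathfrak{s}^{1}_{4,1}(2))$: $e_1\cdot e_1=e_4$, $e_1\cdot x=2e_3+\alpha_1e_4$, $e_2\cdot x=\alpha_2e_4$, $x\cdot x=2e_2+2\alpha_1e_3+\alpha_3e_4$; $\mathbf{TP}_5(\mathfrak{s}^{1}_{4,1}(2))$: $e_1\cdot e_2=\alpha_1e_4$, $e_2\cdot e_2=\alpha_2e_4$, $e_1\cdot x=\alpha_3e_4$, $e_2\cdot x=2\alpha_1e_3+\alpha_4e_4$, $e_3\cdot x=\alpha_1e_4$, $x\cdot x=2\alpha_1e_1+2\alpha_3e_3+\alpha_5e_4$; $\mathbf{TP}_6(\mathfrak{s}^{1}_{4,1}(\beta))$, $\beta\neq1,2$: $e_1\cdot e_1=\alpha_1e_4$, $e_1\cdot x=\beta\alpha_1e_3+\alpha_2e_4$, $x\cdot x=(\beta-1)\beta\alpha_1e_2+\beta\alpha_2e_3+\alpha_3e_4$. Here the transposed Poisson algebra also has its products with respect to the bracket $[-,-]$, and the remaining products of basis elements under $\cdot$ (those not listed, up to commutativity) are equal to zero.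
   Context: All algebras are over $\mathbb{C}$. A transposed Poisson algebra is a vector space $\mathfrak{L}$ with bilinear operations $\cdot$ and $[-,-]$ such that $(\mathfrak{L},\cdot)$ is a commutative associative algebra, $(\mathfrak{L},[-,-])$ is a Lie algebra, and $2z\cdot[u,v]=[z\cdot u,v]+[u,z\cdot v]$ for all $u,v,z\in\mathfrak{L}$. A transposed Poisson structure on a Lie algebra $(\mathfrak{L},[-,-])$ is an operation $\cdot$ making $(\mathfrak{L},\cdot,[-,-])$ a transposed Poisson algebra. $\mathfrak{s}^{1}_{4,1}(\beta)$ is the $5$-dimensional Lie algebra with basis $e_1,e_2,e_3,e_4,x$ and brackets $[e_2,e_1]=e_3$, $[e_3,e_1]=e_4$, $[e_1,x]=e_1$, $[e_i,x]=(i-2+\beta)e_i$ for $2\le i\le 4$; brackets of basis elements not determined by these and antisymmetry are zero.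
   Formalization: The forms TP2, TP3, TP4 are reached only up to isomorphism of transposed Poisson algebras, not in the given basis; literally the claim fails for β=2, e.g. for e1·e1=2e4, e1·x=4e3, x·x=4e2 with all other products zero. *)

theory Defs
  imports "HOL-Analysis.Analysis"
begin

definition bilinear_op :: "(complex \<Rightarrow> 'a::ab_group_add \<Rightarrow> 'a) \<Rightarrow> ('a \<Rightarrow> 'a \<Rightarrow> 'a) \<Rightarrow> bool" where
  "bilinear_op smul f \<longleftrightarrow>
     (\<forall>u. Vector_Spaces.linear smul smul (\<lambda>v. f u v)) \<and>
     (\<forall>v. Vector_Spaces.linear smul smul (\<lambda>u. f u v))"

locale lie_algebra = vector_space smul
  for smul :: "complex \<Rightarrow> 'a::ab_group_add \<Rightarrow> 'a" +
  fixes bracket :: "'a \<Rightarrow> 'a \<Rightarrow> 'a"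
  assumes bracket_bilinear: "bilinear_op smul bracket"
    and bracket_self: "bracket u u = 0"
    and jacobi: "bracket u (bracket v w) + bracket v (bracket w u) + bracket w (bracket u v) = 0"

locale comm_assoc_algebra = vector_space smul
  for smul :: "complex \<Rightarrow> 'a::ab_group_add \<Rightarrow> 'a" +
  fixes dot :: "'a \<Rightarrow> 'a \<Rightarrow> 'a"
  assumes mult_bilinear: "bilinear_op smul dot"
    and mult_commute: "dot u v = dot v u"
    and mult_assoc: "dot (dot u v) w = dot u (dot v w)"

locale transposed_poisson_algebra =
  comm_assoc_algebra smul dot + lie_algebra smul bracket
  for smul :: "complex \<Rightarrow> 'a::ab_group_add \<Rightarrow> 'a"
    and dot :: "'a \<Rightarrow> 'a \<Rightarrow> 'a"
    and bracket :: "'a \<Rightarrow> 'a \<Rightarrow> 'a" +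
  assumes transposed_leibniz:
    "smul 2 (dot z (bracket u v)) = bracket (dot z u) v + bracket u (dot z v)"

definition transposed_poisson_iso ::
  "(complex \<Rightarrow> 'a::ab_group_add \<Rightarrow> 'a) \<Rightarrow> ('a \<Rightarrow> 'a \<Rightarrow> 'a) \<Rightarrow> ('a \<Rightarrow> 'a \<Rightarrow> 'a) \<Rightarrow>
   (complex \<Rightarrow> 'b::ab_group_add \<Rightarrow> 'b) \<Rightarrow> ('b \<Rightarrow> 'b \<Rightarrow> 'b) \<Rightarrow> ('b \<Rightarrow> 'b \<Rightarrow> 'b) \<Rightarrow>
   ('a \<Rightarrow> 'b) \<Rightarrow> bool" where
  "transposed_poisson_iso smul dot bracket smul' dot' bracket' f \<longleftrightarrow>
     Vector_Spaces.linear smul smul' f \<and> bij f \<and>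
     (\<forall>u v. f (dot u v) = dot' (f u) (f v)) \<and>
     (\<forall>u v. f (bracket u v) = bracket' (f u) (f v))"

abbreviation e1 :: "complex ^ 5" where "e1 \<equiv> axis 1 1"
abbreviation e2 :: "complex ^ 5" where "e2 \<equiv> axis 2 1"
abbreviation e3 :: "complex ^ 5" where "e3 \<equiv> axis 3 1"
abbreviation e4 :: "complex ^ 5" where "e4 \<equiv> axis 4 1"
abbreviation ex :: "complex ^ 5" where "ex \<equiv> axis 5 1"

text \<open>The Lie algebra \<open>s\<^sup>1\<^sub>4\<^sub>,\<^sub>1(\<beta>)\<close> lives on \<open>complex ^ 5\<close>; the standard basis vectors
  \<open>e1, e2, e3, e4, ex\<close> play the roles of \<open>e\<^sub>1, e\<^sub>2, e\<^sub>3, e\<^sub>4, x\<close>. The bracket is the bilinear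
  alternating extension of the table in \<open>s41_bracket_basis\<close> below.\<close>

definition s41_bracket :: "complex \<Rightarrow> complex ^ 5 \<Rightarrow> complex ^ 5 \<Rightarrow> complex ^ 5" where
  "s41_bracket \<beta> u v =
     (u$2 * v$1 - u$1 * v$2) *s e3 +
     (u$3 * v$1 - u$1 * v$3) *s e4 +
     (u$1 * v$5 - u$5 * v$1) *s e1 +
     ((u$2 * v$5 - u$5 * v$2) * \<beta>) *s e2 +
     ((u$3 * v$5 - u$5 * v$3) * (1 + \<beta>)) *s e3 +
     ((u$4 * v$5 - u$5 * v$4) * (2 + \<beta>)) *s e4"

lemma exhaust_5: "i = 1 \<or> i = 2 \<or> i = 3 \<or> i = 4 \<or> i = 5" for i :: 5
proof (induct i)
  case (of_int z)
  then have "z = 0 \<or> z = 1 \<or> z = 2 \<or> z = 3 \<or> z = 4"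
    by simp arith
  then show ?case by auto
qed

lemma forall_5: "(\<forall>i::5. P i) \<longleftrightarrow> P 1 \<and> P 2 \<and> P 3 \<and> P 4 \<and> P 5"
  by (metis exhaust_5)

lemma s41_bracket_basis:
  "s41_bracket \<beta> e2 e1 = e3"
  "s41_bracket \<beta> e3 e1 = e4"
  "s41_bracket \<beta> e1 ex = e1"
  "s41_bracket \<beta> e2 ex = \<beta> *s e2"
  "s41_bracket \<beta> e3 ex = (1 + \<beta>) *s e3"
  "s41_bracket \<beta> e4 ex = (2 + \<beta>) *s e4"
  "s41_bracket \<beta> e1 e4 = 0"
  "s41_bracket \<beta> e2 e3 = 0"
  "s41_bracket \<beta> e2 e4 = 0"
  "s41_bracket \<beta> e3 e4 = 0"
  by (simp_all add: s41_bracket_def axis_def)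

lemma lie_algebra_s41: "lie_algebra (*s) (s41_bracket \<beta>)"
proof
  show "bilinear_op (*s) (s41_bracket \<beta>)"
    unfolding bilinear_op_def
    by (intro conjI allI; unfold_locales)
       (simp_all add: s41_bracket_def vec_eq_iff forall_5 axis_def algebra_simps)
qed (simp_all add: s41_bracket_def vec_eq_iff forall_5 axis_def algebra_simps)

text \<open>\<open>has_products m T\<close>: on the basis, the commutative product \<open>m\<close> is given by the partial
  table \<open>T\<close>, which lists each product in one order only; products of basis vectors listed in
  neither order vanish.\<close>

definition has_products ::
  "(complex ^ 5 \<Rightarrow> complex ^ 5 \<Rightarrow> complex ^ 5) \<Rightarrow> ((complex ^ 5) \<times> (complex ^ 5) \<rightharpoonup> complex ^ 5) \<Rightarrow> bool" where
  "has_products m T \<longleftrightarrow>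
     (\<forall>u \<in> {e1, e2, e3, e4, ex}. \<forall>v \<in> {e1, e2, e3, e4, ex}.
        m u v = (case T (u, v) of Some w \<Rightarrow> w
                 | None \<Rightarrow> (case T (v, u) of Some w \<Rightarrow> w | None \<Rightarrow> 0)))"

definition TP1 where
  "TP1 \<alpha>1 \<alpha>2 \<alpha>3 \<alpha>4 m \<longleftrightarrow> has_products m
     [(e1, e1) \<mapsto> \<alpha>1 *s e3 + \<alpha>2 *s e4,
      (e1, ex) \<mapsto> \<alpha>2 *s e3 + \<alpha>3 *s e4,
      (ex, ex) \<mapsto> \<alpha>3 *s e3 + \<alpha>4 *s e4]"

definition TP2 where
  "TP2 \<alpha>1 \<alpha>2 \<alpha>3 \<alpha>4 \<alpha>5 m \<longleftrightarrow> has_products m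
     [(e1, e1) \<mapsto> e2 + \<alpha>1 *s e3 + \<alpha>2 *s e4,
      (e1, e2) \<mapsto> \<alpha>3 *s e3 + (1/2 * \<alpha>1 * \<alpha>3) *s e4,
      (e1, e3) \<mapsto> (1/2 * \<alpha>3) *s e4,
      (e2, e2) \<mapsto> (1/2 * \<alpha>3^2) *s e4,
      (e1, ex) \<mapsto> \<alpha>3 *s e1 + \<alpha>1 *s e2 + (2 * \<alpha>2) *s e3 + \<alpha>4 *s e4,
      (e2, ex) \<mapsto> \<alpha>3 *s e2 + (\<alpha>1 * \<alpha>3) *s e3 + (\<alpha>2 * \<alpha>3) *s e4,
      (e3, ex) \<mapsto> \<alpha>3 *s e3 + (1/2 * \<alpha>1 * \<alpha>3) *s e4,
      (e4, ex) \<mapsto> \<alpha>3 *s e4,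
      (ex, ex) \<mapsto> (\<alpha>1 * \<alpha>3) *s e1 + (2 * \<alpha>2) *s e2 + (2 * \<alpha>4) *s e3 + \<alpha>5 *s e4 + \<alpha>3 *s ex]"

definition TP3 where
  "TP3 \<alpha>1 \<alpha>2 \<alpha>3 \<alpha>4 m \<longleftrightarrow> has_products m
     [(e1, e1) \<mapsto> e3 + \<alpha>1 *s e4,
      (e1, e2) \<mapsto> \<alpha>2 *s e4,
      (e1, ex) \<mapsto> e2 + (2 * \<alpha>1) *s e3 + \<alpha>3 *s e4,
      (e2, ex) \<mapsto> (2 * \<alpha>2) *s e3 + (2 * \<alpha>1 * \<alpha>2) *s e4,
      (e3, ex) \<mapsto> \<alpha>2 *s e4,
      (ex, ex) \<mapsto> (2 * \<alpha>2) *s e1 + (2 * \<alpha>1) *s e2 + (2 * \<alpha>3) *s e3 + \<alpha>4 *s e4]"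

definition TP4 where
  "TP4 \<alpha>1 \<alpha>2 \<alpha>3 m \<longleftrightarrow> has_products m
     [(e1, e1) \<mapsto> e4,
      (e1, ex) \<mapsto> 2 *s e3 + \<alpha>1 *s e4,
      (e2, ex) \<mapsto> \<alpha>2 *s e4,
      (ex, ex) \<mapsto> 2 *s e2 + (2 * \<alpha>1) *s e3 + \<alpha>3 *s e4]"

definition TP5 where
  "TP5 \<alpha>1 \<alpha>2 \<alpha>3 \<alpha>4 \<alpha>5 m \<longleftrightarrow> has_products m
     [(e1, e2) \<mapsto> \<alpha>1 *s e4,
      (e2, e2) \<mapsto> \<alpha>2 *s e4,
      (e1, ex) \<mapsto> \<alpha>3 *s e4,
      (e2, ex) \<mapsto> (2 * \<alpha>1) *s e3 + \<alpha>4 *s e4,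
      (e3, ex) \<mapsto> \<alpha>1 *s e4,
      (ex, ex) \<mapsto> (2 * \<alpha>1) *s e1 + (2 * \<alpha>3) *s e3 + \<alpha>5 *s e4]"

definition TP6 where
  "TP6 \<beta> \<alpha>1 \<alpha>2 \<alpha>3 m \<longleftrightarrow> has_products m
     [(e1, e1) \<mapsto> \<alpha>1 *s e4,
      (e1, ex) \<mapsto> (\<beta> * \<alpha>1) *s e3 + \<alpha>2 *s e4,
      (ex, ex) \<mapsto> ((\<beta> - 1) * \<beta> * \<alpha>1) *s e2 + (\<beta> * \<alpha>2) *s e3 + \<alpha>3 *s e4]"

text \<open>In \<open>TP2\<close>, \<open>TP3\<close>, \<open>TP4\<close> the leading coefficient of \<open>e1 \<cdot> e1\<close> is normalised to \<open>1\<close>, so these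
  forms can only be reached after a change of basis, i.e. up to an isomorphism of transposed
  Poisson algebras (for example \<open>e1 \<cdot> e1 = 2 *s e4\<close>, \<open>e1 \<cdot> ex = 4 *s e3\<close>, \<open>ex \<cdot> ex = 4 *s e2\<close> is a
  structure on \<open>s\<^sup>1\<^sub>4\<^sub>,\<^sub>1(2)\<close> with none of the listed forms on the nose). The form is
  realised by a second structure \<open>m'\<close> on the same Lie algebra.\<close>

definition iso_to_form ::
  "complex \<Rightarrow> (complex ^ 5 \<Rightarrow> complex ^ 5 \<Rightarrow> complex ^ 5) \<Rightarrow>
   ((complex ^ 5 \<Rightarrow> complex ^ 5 \<Rightarrow> complex ^ 5) \<Rightarrow> bool) \<Rightarrow> bool" where
  "iso_to_form \<beta> m P \<longleftrightarrow>
     (\<exists>m' f. transposed_poisson_algebra (*s) m' (s41_bracket \<beta>) \<and>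
             transposed_poisson_iso (*s) m (s41_bracket \<beta>) (*s) m' (s41_bracket \<beta>) f \<and> P m')"

end

theory Submission
  imports Defs
begin

text \<open>Each multiplication operator \<open>m z\<close> is a half-derivation of the Lie algebra, and these
  operators form an explicit linear family. Matching the families for the five basis vectors by
  commutativity leaves a product with few parameters; associativity is only needed for \<open>\<beta> = 2\<close>,
  where it is the vanishing of six quadratic expressions. The Lie automorphisms fixing \<open>e1\<close>, \<open>ex\<close>
  and scaling \<open>e2\<close>, \<open>e3\<close>, \<open>e4\<close> by a common factor then normalise the first nonzero coefficient
  of \<open>m e1 e1\<close> to \<open>1\<close>, and the position of that coefficient distinguishes the forms
  \<open>TP2\<close>, \<open>TP3\<close>, \<open>TP4\<close>, \<open>TP5\<close>.\<close>

section \<open>Half-derivations of the Lie algebra\<close>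

text \<open>Bracketing with \<open>ex\<close> is diagonal on the basis, so the pairs containing
  \<open>ex\<close> fix most coordinates up to factors such as \<open>\<beta> - 2\<close>. The pairs
  with \<open>e1\<close> express the images of \<open>e3\<close> and \<open>e4\<close> through those
  of \<open>e1\<close> and \<open>e2\<close>, and cover the values of \<beta> at which the diagonal
  factors vanish.\<close>

lemma half_derivation_s41:
  fixes \<phi> :: "complex ^ 5 \<Rightarrow> complex ^ 5"
  assumes lin: "Vector_Spaces.linear (*s) (*s) \<phi>"
    and half: "\<And>u v. 2 *s \<phi> (s41_bracket \<beta> u v) = s41_bracket \<beta> (\<phi> u) v + s41_bracket \<beta> u (\<phi> v)"
  obtains q r s t a b w where
    "\<phi> e1 = q *s e1 + a *s e2 + s *s e3 + t *s e4"
    "\<phi> e2 = q *s e2 + r *s e3 + b *s e4"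
    "\<phi> e3 = q *s e3 + (r / 2) *s e4"
    "\<phi> e4 = q *s e4"
    "\<phi> ex = ((\<beta> - 1) * r) *s e1 + ((\<beta> - 1) * s) *s e2 + (\<beta> * t) *s e3 + w *s e4 + q *s ex"
    "\<beta> \<noteq> 2 \<Longrightarrow> a = 0" "\<beta> \<noteq> 2 \<Longrightarrow> b = 0" "\<beta> \<noteq> 2 \<Longrightarrow> r = 0"
proof -
  interpret \<phi>: Vector_Spaces.linear "(*s)" "(*s)" \<phi> by (rule lin)
  define p where "p i j = \<phi> (axis i 1) $ j" for i j
  have "2 *s \<phi> e1 = s41_bracket \<beta> (\<phi> e1) ex + s41_bracket \<beta> e1 (\<phi> ex)"
    using half[of e1 ex] by (simp add: s41_bracket_basis)
  then have r15: "2 * p 1 1 = p 1 1 + p 5 5" "2 * p 1 2 = p 1 2 * \<beta>"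
      "2 * p 1 3 = p 1 3 * (1 + \<beta>) - p 5 2" "2 * p 1 4 = p 1 4 * (2 + \<beta>) - p 5 3" "p 1 5 = 0"
    by (simp_all add: vec_eq_iff forall_5 s41_bracket_def p_def axis_def)
  have h15: "p 1 1 = p 5 5" "(\<beta> - 2) * p 1 2 = 0" "p 5 2 = (\<beta> - 1) * p 1 3"
      "p 5 3 = \<beta> * p 1 4"
    using r15 by algebra+
  have "(2 * \<beta>) *s \<phi> e2 = s41_bracket \<beta> (\<phi> e2) ex + s41_bracket \<beta> e2 (\<phi> ex)"
    using half[of e2 ex] by (simp add: s41_bracket_basis \<phi>.scale)
  then have r25: "2 * \<beta> * p 2 2 = p 2 2 * \<beta> + p 5 5 * \<beta>"
      "2 * \<beta> * p 2 3 = p 5 1 + p 2 3 * (1 + \<beta>)" "2 * \<beta> * p 2 4 = p 2 4 * (2 + \<beta>)"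
      "\<beta> * p 2 5 = 0"
    by (simp_all add: vec_eq_iff forall_5 s41_bracket_def p_def axis_def)
  have h25: "\<beta> * (p 2 2 - p 5 5) = 0" "p 5 1 = (\<beta> - 1) * p 2 3"
      "(\<beta> - 2) * p 2 4 = 0"
    using r25 by algebra+
  have "(2 * (1 + \<beta>)) *s \<phi> e3 = s41_bracket \<beta> (\<phi> e3) ex + s41_bracket \<beta> e3 (\<phi> ex)"
    using half[of e3 ex] by (simp only: s41_bracket_basis \<phi>.scale vector_smult_assoc)
  then have h35: "(1 + \<beta>) * (p 3 3 - p 5 5) = 0" "\<beta> * p 3 4 = p 5 1"
    by (simp_all add: vec_eq_iff forall_5 s41_bracket_def p_def axis_def algebra_simps)
  have "2 *s \<phi> e3 = s41_bracket \<beta> (\<phi> e2) e1 + s41_bracket \<beta> e2 (\<phi> e1)"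
    using half[of e2 e1] by (simp add: s41_bracket_basis)
  then have h21: "2 * p 3 1 = - p 2 5" "2 * p 3 2 = \<beta> * p 1 5" "2 * p 3 3 = p 2 2 + p 1 1"
      "2 * p 3 4 = p 2 3" "p 3 5 = 0"
    by (simp_all add: vec_eq_iff forall_5 s41_bracket_def p_def axis_def)
  have "2 *s \<phi> e4 = s41_bracket \<beta> (\<phi> e3) e1 + s41_bracket \<beta> e3 (\<phi> e1)"
    using half[of e3 e1] by (simp add: s41_bracket_basis)
  then have h31: "2 * p 4 1 = - p 3 5" "p 4 2 = 0" "2 * p 4 3 = p 3 2 + (1 + \<beta>) * p 1 5"
      "2 * p 4 4 = p 3 3 + p 1 1" "p 4 5 = 0"
    by (simp_all add: vec_eq_iff forall_5 s41_bracket_def p_def axis_def)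
  have "0 = s41_bracket \<beta> (\<phi> e2) e3 + s41_bracket \<beta> e2 (\<phi> e3)"
    using half[of e2 e3] by (simp add: s41_bracket_basis \<phi>.zero)
  then have r23: "p 3 1 - p 2 5 * (1 + \<beta>) = 0" and p21: "p 2 1 = 0"
    by (simp_all add: vec_eq_iff forall_5 s41_bracket_def p_def axis_def)
  \<comment> \<open>Since \<open>\<beta> * p 2 5 = 0\<close>, \<open>r23\<close> reads
    \<open>p 3 1 = p 2 5\<close>, whereas \<open>h21(1)\<close> says
    \<open>2 * p 3 1 = - p 2 5\<close>.\<close>
  have "3 * p 2 5 = 0" using h21(1) r23 r25(4) by algebra
  then have z: "p 2 5 = 0" "p 3 1 = 0" "p 3 2 = 0" "p 4 1 = 0" "p 4 3 = 0"
    using h21 h31 r15 by auto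
  \<comment> \<open>For \<beta> nonzero, \<open>h25(1)\<close> yields the first equation; for
    \<beta> zero, \<open>h35(1)\<close> yields the second. In either case
    \<open>2 * p 3 3 = p 2 2 + p 1 1\<close> supplies the other.\<close>
  have "p 2 2 = p 5 5 \<and> p 3 3 = p 5 5"
    using h25(1) h35(1) h21(3) h15(1) by (cases "\<beta> = 0") auto
  then have d: "p 2 2 = p 5 5" "p 3 3 = p 5 5" "p 4 4 = p 5 5" "p 1 1 = p 5 5"
    using h31(4) h15(1) by auto
  \<comment> \<open>\<open>p 5 1\<close> is computed twice: as \<open>(\<beta> - 1) * p 2 3\<close>
    from \<open>e2\<close>, and as \<open>\<beta> * p 2 3 / 2\<close> from
    \<open>e3\<close>.\<close>
  have r: "(\<beta> - 2) * p 2 3 = 0"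
    using h35(2) h25(2) h21(4) by algebra
  have r2: "p 3 4 = p 2 3 / 2" using h21(4) by (simp add: field_simps)
  show thesis
  proof (rule that[where q = "p 5 5" and a = "p 1 2" and s = "p 1 3" and t = "p 1 4" and r = "p 2 3"
          and b = "p 2 4" and w = "p 5 4"])
    show "\<phi> e1 = p 5 5 *s e1 + p 1 2 *s e2 + p 1 3 *s e3 + p 1 4 *s e4"
      using d r15(5) by (simp add: vec_eq_iff forall_5 axis_def p_def)
    show "\<phi> e2 = p 5 5 *s e2 + p 2 3 *s e3 + p 2 4 *s e4"
      using d z r25 p21 by (simp add: vec_eq_iff forall_5 axis_def p_def)
    show "\<phi> e3 = p 5 5 *s e3 + (p 2 3 / 2) *s e4"
      using d z r2 h21 by (simp add: vec_eq_iff forall_5 axis_def p_def)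
    show "\<phi> e4 = p 5 5 *s e4"
      using d z h31 by (simp add: vec_eq_iff forall_5 axis_def p_def)
    show "\<phi> ex = ((\<beta> - 1) * p 2 3) *s e1 + ((\<beta> - 1) * p 1 3) *s e2 + (\<beta> * p 1 4) *s e3 +
        p 5 4 *s e4 + p 5 5 *s ex"
      using h25(2) h15 by (simp add: vec_eq_iff forall_5 axis_def p_def)
  qed (use r h15 h25 in auto)
qed

section \<open>Transport of structures along Lie automorphisms\<close>

text \<open>A Lie automorphism leaves the bracket alone, so conjugating only the product gives an
  isomorphic structure on the same Lie algebra. The inverse \<open>g\<close> inherits linearity and
  compatibility with the bracket from \<open>f\<close>.\<close>

lemma transposed_poisson_transport:
  assumes tp: "transposed_poisson_algebra smul dot bracket"
    and lin: "Vector_Spaces.linear smul smul f" and gf: "\<And>u. g (f u) = u" and fg: "\<And>u. f (g u) = u"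
    and hom: "\<And>u v. f (bracket u v) = bracket (f u) (f v)"
  defines "dot' \<equiv> \<lambda>u v. f (dot (g u) (g v))"
  shows "transposed_poisson_algebra smul dot' bracket"
    and "transposed_poisson_iso smul dot bracket smul dot' bracket f"
proof -
  interpret tp: transposed_poisson_algebra smul dot bracket by (rule tp)
  interpret f: Vector_Spaces.linear smul smul f by (rule lin)
  have g_add: "g (u + v) = g u + g v" for u v by (metis f.add fg gf)
  have g_scale: "g (smul c u) = smul c (g u)" for c u by (metis f.scale fg gf)
  have g_br: "g (bracket u v) = bracket (g u) (g v)" for u v by (metis hom fg gf)
  have bil: "dot u (v + w) = dot u v + dot u w" "dot (v + w) u = dot v u + dot w u"
     "dot u (smul c v) = smul c (dot u v)" "dot (smul c v) u = smul c (dot v u)" for u v w c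
    using tp.mult_bilinear unfolding bilinear_op_def
    by (simp_all add: Vector_Spaces.linear_iff)
  show "transposed_poisson_algebra smul dot' bracket"
  proof unfold_locales
    show "bilinear_op smul dot'"
      unfolding bilinear_op_def dot'_def
      by (simp add: Vector_Spaces.linear_iff g_add g_scale bil f.add f.scale tp.vector_space_axioms)
    show "dot' u v = dot' v u" for u v
      by (simp add: dot'_def tp.mult_commute)
    show "dot' (dot' u v) w = dot' u (dot' v w)" for u v w
      by (simp add: dot'_def gf tp.mult_assoc)
    show "smul 2 (dot' z (bracket u v)) = bracket (dot' z u) v + bracket u (dot' z v)" for z u v
      unfolding dot'_def g_br f.scale[symmetric] tp.transposed_leibniz
      by (simp add: f.add hom fg)
  qed
  have "bij f" by (rule bijI') (metis gf, metis fg)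
  then show "transposed_poisson_iso smul dot bracket smul dot' bracket f"
    by (simp add: transposed_poisson_iso_def dot'_def lin gf hom)
qed

definition scaling :: "complex \<Rightarrow> complex ^ 5 \<Rightarrow> complex ^ 5" where
  "scaling t u = (\<chi> i. if i = 2 \<or> i = 3 \<or> i = 4 then t * u $ i else u $ i)"

lemma scaling_nth: "scaling t u $ i = (if i = 2 \<or> i = 3 \<or> i = 4 then t * u $ i else u $ i)"
  by (simp add: scaling_def)

lemma linear_scaling: "Vector_Spaces.linear (*s) (*s) (scaling t)"
  by unfold_locales (auto simp: scaling_def vec_eq_iff algebra_simps)

lemma scaling_basis:
  "scaling t e1 = e1" "scaling t e2 = t *s e2" "scaling t e3 = t *s e3"
  "scaling t e4 = t *s e4" "scaling t ex = ex"
  by (simp_all add: scaling_def vec_eq_iff forall_5 axis_def)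

text \<open>\<open>e2\<close>, \<open>e3\<close>, \<open>e4\<close> span an abelian ideal and
  \<open>e1\<close>, \<open>ex\<close> a complementary subalgebra, so multiplying the ideal by a
  scalar respects all brackets.\<close>

lemma scaling_bracket: "scaling t (s41_bracket \<beta> u v) = s41_bracket \<beta> (scaling t u) (scaling t v)"
  by (simp add: scaling_nth s41_bracket_def vec_eq_iff forall_5 axis_def algebra_simps)

lemma scaling_inverse: "t \<noteq> 0 \<Longrightarrow> scaling (1 / t) (scaling t u) = u"
  by (simp add: scaling_nth vec_eq_iff)

text \<open>The isomorphism is \<open>scaling (1 / t)\<close>. It divides the \<open>e2\<close>,
  \<open>e3\<close>, \<open>e4\<close> coefficients of \<open>m e1 e1\<close> by \<open>t\<close>,
  so \<open>t\<close> can be taken to be the coefficient that should become 1.\<close>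

lemma iso_to_formI:
  assumes tp: "transposed_poisson_algebra (*s) m (s41_bracket \<beta>)" and t: "t \<noteq> 0"
    and P: "P (\<lambda>u v. scaling (1 / t) (m (scaling t u) (scaling t v)))"
  shows "iso_to_form \<beta> m P"
proof -
  have inv: "scaling t (scaling (1 / t) u) = u" for u
    using scaling_inverse[of "1 / t" u] t by simp
  note transport = transposed_poisson_transport[where smul = "(*s)" and dot = m and
      bracket = "s41_bracket \<beta>" and f = "scaling (1 / t)" and g = "scaling t"]
  show ?thesis
    unfolding iso_to_form_def
  proof (intro exI conjI)
    show "transposed_poisson_algebra (*s) (\<lambda>u v. scaling (1 / t) (m (scaling t u) (scaling t v)))
        (s41_bracket \<beta>)"
      by (rule transport(1)) (simp_all only: tp linear_scaling inv scaling_inverse[OF t] scaling_bracket)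
    show "transposed_poisson_iso (*s) m (s41_bracket \<beta>) (*s)
        (\<lambda>u v. scaling (1 / t) (m (scaling t u) (scaling t v))) (s41_bracket \<beta>) (scaling (1 / t))"
      by (rule transport(2)) (simp_all only: tp linear_scaling inv scaling_inverse[OF t] scaling_bracket)
  qed (rule P)
qed

section \<open>Shape of the product and its quadratic relations\<close>

lemma transposed_poisson_half_derivation:
  assumes "transposed_poisson_algebra (*s) m (s41_bracket \<beta>)"
  obtains q r s t a b w where
    "m z e1 = q *s e1 + a *s e2 + s *s e3 + t *s e4"
    "m z e2 = q *s e2 + r *s e3 + b *s e4"
    "m z e3 = q *s e3 + (r / 2) *s e4"
    "m z e4 = q *s e4"
    "m z ex = ((\<beta> - 1) * r) *s e1 + ((\<beta> - 1) * s) *s e2 + (\<beta> * t) *s e3 + w *s e4 + q *s ex"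
    "\<beta> \<noteq> 2 \<Longrightarrow> a = 0" "\<beta> \<noteq> 2 \<Longrightarrow> b = 0" "\<beta> \<noteq> 2 \<Longrightarrow> r = 0"
proof -
  interpret transposed_poisson_algebra "(*s)" m "s41_bracket \<beta>" by (rule assms)
  have "Vector_Spaces.linear (*s) (*s) (m z)"
    using mult_bilinear by (simp add: bilinear_op_def)
  from half_derivation_s41[OF this transposed_leibniz] that show thesis by metis
qed

text \<open>The shape common to \<open>TP2\<close>, \<open>TP3\<close>, \<open>TP4\<close> and
  \<open>TP5\<close>: what commutativity and the transposed Leibniz rule force at \<beta> = 2,
  before associativity relates the nine parameters.\<close>

definition products_2 where
  "products_2 a b c d f g h k l m \<longleftrightarrow> has_products m
     [(e1, e1) \<mapsto> a *s e2 + b *s e3 + c *s e4,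
      (e1, e2) \<mapsto> d *s e3 + f *s e4,
      (e1, e3) \<mapsto> (d / 2) *s e4,
      (e2, e2) \<mapsto> h *s e4,
      (e1, ex) \<mapsto> d *s e1 + b *s e2 + (2 * c) *s e3 + g *s e4,
      (e2, ex) \<mapsto> d *s e2 + (2 * f) *s e3 + k *s e4,
      (e3, ex) \<mapsto> d *s e3 + f *s e4,
      (e4, ex) \<mapsto> d *s e4,
      (ex, ex) \<mapsto> (2 * f) *s e1 + (2 * c) *s e2 + (2 * g) *s e3 + l *s e4 + d *s ex]"

text \<open>Each product of two distinct basis vectors arises from two half-derivation families, one
  per factor; equating coordinates removes most parameters. The digit in a parameter name records
  the multiplying basis vector, with 5 for \<open>ex\<close>.\<close>

lemma structure_shape:
  assumes tp: "transposed_poisson_algebra (*s) m (s41_bracket \<beta>)"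
  shows "\<beta> = 2 \<Longrightarrow> \<exists>a b c d f g h k l. products_2 a b c d f g h k l m"
    and "\<beta> \<noteq> 2 \<Longrightarrow> \<exists>b c g l. (\<beta> - 1) * b = 0 \<and> has_products m
     [(e1, e1) \<mapsto> b *s e3 + c *s e4,
      (e1, ex) \<mapsto> (\<beta> * c) *s e3 + g *s e4,
      (ex, ex) \<mapsto> ((\<beta> - 1) * \<beta> * c) *s e2 + (\<beta> * g) *s e3 + l *s e4]"
proof -
  interpret transposed_poisson_algebra "(*s)" m "s41_bracket \<beta>" by (rule tp)
  obtain q1 r1 s1 t1 a1 b1 w1 where d1:
    "m e1 e1 = q1 *s e1 + a1 *s e2 + s1 *s e3 + t1 *s e4"
    "m e1 e2 = q1 *s e2 + r1 *s e3 + b1 *s e4"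
    "m e1 e3 = q1 *s e3 + (r1 / 2) *s e4"
    "m e1 e4 = q1 *s e4"
    "m e1 ex = ((\<beta> - 1) * r1) *s e1 + ((\<beta> - 1) * s1) *s e2 + (\<beta> * t1) *s e3 + w1 *s e4 + q1 *s ex"
    and z1: "\<beta> \<noteq> 2 \<Longrightarrow> a1 = 0" "\<beta> \<noteq> 2 \<Longrightarrow> b1 = 0" "\<beta> \<noteq> 2 \<Longrightarrow> r1 = 0"
    using transposed_poisson_half_derivation[OF tp, of e1] by metis
  obtain q2 r2 s2 t2 a2 b2 w2 where d2:
    "m e2 e1 = q2 *s e1 + a2 *s e2 + s2 *s e3 + t2 *s e4"
    "m e2 e2 = q2 *s e2 + r2 *s e3 + b2 *s e4"
    "m e2 e3 = q2 *s e3 + (r2 / 2) *s e4"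
    "m e2 e4 = q2 *s e4"
    "m e2 ex = ((\<beta> - 1) * r2) *s e1 + ((\<beta> - 1) * s2) *s e2 + (\<beta> * t2) *s e3 + w2 *s e4 + q2 *s ex"
    and z2: "\<beta> \<noteq> 2 \<Longrightarrow> a2 = 0" "\<beta> \<noteq> 2 \<Longrightarrow> b2 = 0" "\<beta> \<noteq> 2 \<Longrightarrow> r2 = 0"
    using transposed_poisson_half_derivation[OF tp, of e2] by metis
  obtain q3 r3 s3 t3 a3 b3 w3 where d3:
    "m e3 e1 = q3 *s e1 + a3 *s e2 + s3 *s e3 + t3 *s e4"
    "m e3 e2 = q3 *s e2 + r3 *s e3 + b3 *s e4"
    "m e3 e3 = q3 *s e3 + (r3 / 2) *s e4"
    "m e3 e4 = q3 *s e4"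
    "m e3 ex = ((\<beta> - 1) * r3) *s e1 + ((\<beta> - 1) * s3) *s e2 + (\<beta> * t3) *s e3 + w3 *s e4 + q3 *s ex"
    using transposed_poisson_half_derivation[OF tp, of e3] by metis
  obtain q4 r4 s4 t4 a4 b4 w4 where d4:
    "m e4 e1 = q4 *s e1 + a4 *s e2 + s4 *s e3 + t4 *s e4"
    "m e4 e2 = q4 *s e2 + r4 *s e3 + b4 *s e4"
    "m e4 e3 = q4 *s e3 + (r4 / 2) *s e4"
    "m e4 e4 = q4 *s e4"
    "m e4 ex = ((\<beta> - 1) * r4) *s e1 + ((\<beta> - 1) * s4) *s e2 + (\<beta> * t4) *s e3 + w4 *s e4 + q4 *s ex"
    using transposed_poisson_half_derivation[OF tp, of e4] by metis
  obtain q5 r5 s5 t5 a5 b5 w5 where d5: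
    "m ex e1 = q5 *s e1 + a5 *s e2 + s5 *s e3 + t5 *s e4"
    "m ex e2 = q5 *s e2 + r5 *s e3 + b5 *s e4"
    "m ex e3 = q5 *s e3 + (r5 / 2) *s e4"
    "m ex e4 = q5 *s e4"
    "m ex ex = ((\<beta> - 1) * r5) *s e1 + ((\<beta> - 1) * s5) *s e2 + (\<beta> * t5) *s e3 + w5 *s e4 + q5 *s ex"
    and z5: "\<beta> \<noteq> 2 \<Longrightarrow> a5 = 0" "\<beta> \<noteq> 2 \<Longrightarrow> b5 = 0" "\<beta> \<noteq> 2 \<Longrightarrow> r5 = 0"
    using transposed_poisson_half_derivation[OF tp, of ex] by metis

  note coords = vec_eq_iff forall_5 axis_def
  have c12: "q2 = 0" "a2 = q1" "s2 = r1" "t2 = b1"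
    using mult_commute[of e1 e2] unfolding d1 d2 by (simp_all add: coords)
  have c13: "q3 = 0" "a3 = 0" "s3 = q1" "r1 = 2 * t3"
    using mult_commute[of e1 e3] unfolding d1 d3 by (simp_all add: coords)
  have c14: "q4 = 0" "a4 = 0" "s4 = 0" "t4 = q1"
    using mult_commute[of e1 e4] unfolding d1 d4 by (simp_all add: coords)
  \<comment> \<open>\<open>q1 = 0\<close> because \<open>m ex e1\<close> has no \<open>ex\<close>
    component.\<close>
  have c15: "q5 = (\<beta> - 1) * r1" "a5 = (\<beta> - 1) * s1" "s5 = \<beta> * t1" "t5 = w1" "q1 = 0"
    using mult_commute[of e1 ex] unfolding d1 d5 by (simp_all add: coords)
  have c23: "r3 = 0" "b3 = r2 / 2"
    using mult_commute[of e2 e3] c12 unfolding d2 d3 by (simp_all add: coords)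
  have c24: "r4 = 0" "b4 = 0"
    using mult_commute[of e2 e4] c12 unfolding d2 d4 by (simp_all add: coords)
  \<comment> \<open>\<open>m ex e2\<close> has no \<open>e1\<close> component. This makes
    \<open>r2\<close> vanish at \<beta> = 2, where \<open>z2\<close> gives nothing.\<close>
  have c25: "(\<beta> - 1) * r2 = 0" "r5 = \<beta> * t2" "b5 = w2"
    using mult_commute[of e2 ex] unfolding d2 d5 by (simp_all add: coords)
  have c35: "w3 = r5 / 2"
    using mult_commute[of e3 ex] unfolding d3 d5 by (simp_all add: coords)
  have c45: "w4 = q5"
    using mult_commute[of e4 ex] unfolding d4 d5 by (simp_all add: coords)
  note c = c12 c13 c14 c15 c23 c24 c25 c35 c45
  note d = d1 d2 d3 d4 d5
  {
    assume "\<beta> = 2"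
    then have "products_2 a1 s1 t1 r1 b1 w1 b2 w2 w5 m"
      using c unfolding products_2_def has_products_def
      by (simp add: d axis_eq_axis)
    then show "\<exists>a b c d f g h k l. products_2 a b c d f g h k l m" by blast
  next
    assume \<beta>: "\<beta> \<noteq> 2"
    then have z: "a1 = 0" "b1 = 0" "r1 = 0" "a2 = 0" "b2 = 0" "r2 = 0" "a5 = 0" "b5 = 0" "r5 = 0"
      using z1 z2 z5 by auto
    \<comment> \<open>By \<open>c15\<close> this is \<open>a5\<close>, the \<open>e2\<close>
      coefficient of \<open>m ex e1\<close>, which vanishes away from \<beta> = 2.\<close>
    then have "(\<beta> - 1) * s1 = 0" using c by simp
    moreover have "has_products m
       [(e1, e1) \<mapsto> s1 *s e3 + t1 *s e4,
        (e1, ex) \<mapsto> (\<beta> * t1) *s e3 + w1 *s e4,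
        (ex, ex) \<mapsto> ((\<beta> - 1) * \<beta> * t1) *s e2 + (\<beta> * w1) *s e3 + w5 *s e4]"
      using c z unfolding has_products_def
      by (simp add: d axis_eq_axis)
    ultimately show "\<exists>b c g l. (\<beta> - 1) * b = 0 \<and> has_products m
     [(e1, e1) \<mapsto> b *s e3 + c *s e4,
      (e1, ex) \<mapsto> (\<beta> * c) *s e3 + g *s e4,
      (ex, ex) \<mapsto> ((\<beta> - 1) * \<beta> * c) *s e2 + (\<beta> * g) *s e3 + l *s e4]" by blast
  }
qed

text \<open>Each relation can be read off in the \<open>e3\<close> or \<open>e4\<close> coordinate
  of the associator of a well-chosen triple; \<open>e1\<close>, \<open>e1\<close>, \<open>ex\<close>
  gives two of them, one in each coordinate.\<close>

lemma products_2_assoc: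
  assumes tp: "transposed_poisson_algebra (*s) m (s41_bracket \<beta>)"
    and P: "products_2 a b c d f g h k l m"
  shows "2 * a * h = d\<^sup>2" "2 * a * f = b * d" "a * k = c * d"
    "b * h = d * f" "b * k = 2 * c * f" "d * k = 2 * c * h"
proof -
  interpret transposed_poisson_algebra "(*s)" m "s41_bracket \<beta>" by (rule tp)
  have bil: "m u (v + w) = m u v + m u w" "m (v + w) u = m v u + m w u"
     "m u (x *s v) = x *s m u v" "m (x *s v) u = x *s m v u" for u v w x
    using mult_bilinear unfolding bilinear_op_def by (simp_all add: Vector_Spaces.linear_iff)
  have T: "m e1 e1 = a *s e2 + b *s e3 + c *s e4" "m e1 e2 = d *s e3 + f *s e4"
    "m e1 e3 = (d / 2) *s e4" "m e1 e4 = 0" "m e2 e2 = h *s e4" "m e3 e2 = 0" "m e4 e2 = 0"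
    "m e1 ex = d *s e1 + b *s e2 + (2 * c) *s e3 + g *s e4"
    "m e2 e1 = d *s e3 + f *s e4" "m e2 e3 = 0" "m e2 e4 = 0"
    "m e2 ex = d *s e2 + (2 * f) *s e3 + k *s e4"
    "m e3 ex = d *s e3 + f *s e4" "m e4 ex = d *s e4"
    "m ex ex = (2 * f) *s e1 + (2 * c) *s e2 + (2 * g) *s e3 + l *s e4 + d *s ex"
    using P unfolding products_2_def has_products_def by (simp_all add: axis_eq_axis)
  note coords = vec_eq_iff forall_5 axis_def
  show "2 * a * h = d\<^sup>2"
    using mult_assoc[of e1 e1 e2, simplified T bil] by (simp add: coords power2_eq_square algebra_simps)
  show "2 * a * f = b * d" "a * k = c * d"
    using mult_assoc[of e1 e1 ex, simplified T bil] by (simp_all add: coords algebra_simps)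
  show "b * h = d * f"
    using mult_assoc[of e2 e1 ex, simplified T bil] by (simp add: coords algebra_simps)
  show "b * k = 2 * c * f"
    using mult_assoc[of e1 ex ex, simplified T bil] by (simp add: coords algebra_simps)
  show "d * k = 2 * c * h"
    using mult_assoc[of e2 ex ex, simplified T bil] by (simp add: coords algebra_simps)
qed

text \<open>Give \<open>e2\<close>, \<open>e3\<close>, \<open>e4\<close> weight 1 and
  \<open>e1\<close>, \<open>ex\<close> weight 0. A structure constant is then multiplied by
  \<open>t\<close> to the weight of its two factors minus that of its output: -1 for
  \<open>a\<close>, \<open>b\<close>, \<open>c\<close>, \<open>g\<close>, \<open>l\<close>, 1 for
  \<open>h\<close>, and 0 for \<open>d\<close>, \<open>f\<close>, \<open>k\<close>.\<close>

lemma products_2_scaling: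
  assumes tp: "transposed_poisson_algebra (*s) m (s41_bracket \<beta>)"
    and t: "t \<noteq> 0" and P: "products_2 a b c d f g h k l m"
  shows "products_2 (a / t) (b / t) (c / t) d f (g / t) (h * t) k (l / t)
    (\<lambda>u v. scaling (1 / t) (m (scaling t u) (scaling t v)))"
proof -
  interpret transposed_poisson_algebra "(*s)" m "s41_bracket \<beta>" by (rule tp)
  have bil: "m u (x *s v) = x *s m u v" "m (x *s v) u = x *s m v u" for u v x
    using mult_bilinear unfolding bilinear_op_def by (simp_all add: Vector_Spaces.linear_iff)
  show ?thesis
    using P t unfolding products_2_def has_products_def
    by (simp add: axis_eq_axis scaling_basis bil) (simp add: scaling_nth vec_eq_iff forall_5 axis_def)
qed

section \<open>Case analysis on \<beta> and on \<open>m e1 e1\<close>\<close>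

theorem theorem3p1:
  fixes \<beta> :: complex
    and m :: "complex ^ 5 \<Rightarrow> complex ^ 5 \<Rightarrow> complex ^ 5"
  assumes "transposed_poisson_algebra (*s) m (s41_bracket \<beta>)"
  shows
    "(\<beta> = 1 \<and> (\<exists>\<alpha>1 \<alpha>2 \<alpha>3 \<alpha>4. TP1 \<alpha>1 \<alpha>2 \<alpha>3 \<alpha>4 m)) \<or>
     (\<beta> = 2 \<and> (\<exists>\<alpha>1 \<alpha>2 \<alpha>3 \<alpha>4 \<alpha>5. iso_to_form \<beta> m (TP2 \<alpha>1 \<alpha>2 \<alpha>3 \<alpha>4 \<alpha>5))) \<or>
     (\<beta> = 2 \<and> (\<exists>\<alpha>1 \<alpha>2 \<alpha>3 \<alpha>4. iso_to_form \<beta> m (TP3 \<alpha>1 \<alpha>2 \<alpha>3 \<alpha>4))) \<or>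
     (\<beta> = 2 \<and> (\<exists>\<alpha>1 \<alpha>2 \<alpha>3. iso_to_form \<beta> m (TP4 \<alpha>1 \<alpha>2 \<alpha>3))) \<or>
     (\<beta> = 2 \<and> (\<exists>\<alpha>1 \<alpha>2 \<alpha>3 \<alpha>4 \<alpha>5. TP5 \<alpha>1 \<alpha>2 \<alpha>3 \<alpha>4 \<alpha>5 m)) \<or>
     (\<beta> \<noteq> 1 \<and> \<beta> \<noteq> 2 \<and> (\<exists>\<alpha>1 \<alpha>2 \<alpha>3. TP6 \<beta> \<alpha>1 \<alpha>2 \<alpha>3 m))"
proof (cases "\<beta> = 2")
  case False
  then obtain b c g l where b: "(\<beta> - 1) * b = 0" and P: "has_products m
     [(e1, e1) \<mapsto> b *s e3 + c *s e4,
      (e1, ex) \<mapsto> (\<beta> * c) *s e3 + g *s e4,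
      (ex, ex) \<mapsto> ((\<beta> - 1) * \<beta> * c) *s e2 + (\<beta> * g) *s e3 + l *s e4]"
    using structure_shape(2)[OF assms] by blast
  show ?thesis
  proof (cases "\<beta> = 1")
    case True
    \<comment> \<open>At \<beta> = 1 the \<open>e2\<close> term of \<open>m ex ex\<close> disappears
      and \<open>b\<close> remains free.\<close>
    with P have "TP1 b c g l m" by (simp add: TP1_def)
    then show ?thesis using True by auto
  next
    case False
    \<comment> \<open>Here \<open>\<beta> - 1\<close> is invertible, so
      \<open>b = 0\<close>.\<close>
    with P b have "TP6 \<beta> c g l m" by (simp add: TP6_def)
    with False \<open>\<beta> \<noteq> 2\<close> show ?thesis by blast
  qed
next
  case True
  then obtain a b c d f g h k l where P: "products_2 a b c d f g h k l m"
    using structure_shape(1)[OF assms] by blast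
  note eqs = products_2_assoc[OF assms P]
  note scaled = products_2_scaling[OF assms _ P]
  note form = iso_to_formI[OF assms]
  consider "a \<noteq> 0" | "a = 0" "b \<noteq> 0" | "a = 0" "b = 0" "c \<noteq> 0" | "a = 0" "b = 0" "c = 0" by blast
  then show ?thesis
  proof cases
    case 1
    \<comment> \<open>The second equation concerns \<open>h * a\<close> because that is the rescaled
      value of \<open>h\<close>.\<close>
    then have "f = 1 / 2 * (b / a) * d" "h * a = 1 / 2 * d\<^sup>2" "k = c / a * d"
      using eqs by (simp_all add: field_simps)
    with scaled[OF 1] 1 have "TP2 (b / a) (c / a) d (g / a) (l / a)
        (\<lambda>u v. scaling (1 / a) (m (scaling a u) (scaling a v)))"
      unfolding products_2_def TP2_def has_products_def by (simp add: axis_eq_axis)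
    from form[OF 1, where P = "TP2 _ _ _ _ _", OF this] True show ?thesis by blast
  next
    case 2
    \<comment> \<open>With \<open>a = 0\<close> the first relation gives \<open>d = 0\<close>; then
      \<open>b * h = d * f\<close> and \<open>b * k = 2 * c * f\<close> are divided by
      \<open>b\<close>.\<close>
    then have "d = 0" "h = 0" "k = 2 * (c / b) * f"
      using eqs by (auto simp: field_simps)
    with scaled[OF 2(2)] 2 have "TP3 (c / b) f (g / b) (l / b)
        (\<lambda>u v. scaling (1 / b) (m (scaling b u) (scaling b v)))"
      unfolding products_2_def TP3_def has_products_def by (simp add: axis_eq_axis)
    from form[OF 2(2), where P = "TP3 _ _ _ _", OF this] True show ?thesis by blast
  next
    case 3
    \<comment> \<open>After \<open>d = 0\<close>, the relations with left sides \<open>d * k\<close>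
      and \<open>b * k\<close> become \<open>2 * c * h = 0\<close> and
      \<open>2 * c * f = 0\<close>.\<close>
    then have "d = 0" "h = 0" "f = 0"
      using eqs by auto
    with scaled[OF 3(3)] 3 have "TP4 (g / c) k (l / c)
        (\<lambda>u v. scaling (1 / c) (m (scaling c u) (scaling c v)))"
      unfolding products_2_def TP4_def has_products_def by (simp add: axis_eq_axis)
    from form[OF 3(3), where P = "TP4 _ _ _", OF this] True show ?thesis by blast
  next
    case 4
    \<comment> \<open>With \<open>m e1 e1 = 0\<close> there is nothing to normalise, so the form
      holds for \<open>m\<close> itself.\<close>
    then have "d = 0" using eqs(1) by simp
    with P 4 have "TP5 f h g k l m"
      unfolding products_2_def TP5_def has_products_def by (simp add: axis_eq_axis)
    with True show ?thesis by blast
  qed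
qed

end
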